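(* Let $\mathcal{B}^0$ be the set of all finite Blaschke products $\phi$ with $\phi(0)=0$ (equivalently, the finite Blaschke products preserving Lebesgue measure $\mu$ on $\mathbb{S}^1$), equipped with the $C^1$-topology on $\mathbb{S}^1$. Then the set of those $\phi\in\mathcal{B}^0$ that are mixing at a double exponential rate is nowhere dense in $\mathcal{B}^0$.
   Context: $\mathbb{S}^1=\{|z|=1\}$, $d\mu(z)=\frac{1}{2\pi i}\frac{dz}{z}$ is normalized Lebesgue measure on $\mathbb{S}^1$. A finite Blaschke product is a map $\phi(z)=e^{i\psi}\prod_{i=1}^q\frac{z-\lambda_i}{1-\overline{\lambda_i}z}$ with $\psi\in[0,2\pi)$, $|\lambda_i|<1$, and some $q\ge1$ (the degree is arbitrary). The $C^1$-topology is given by the metric $d_{C^1}(\phi,\widetilde\phi)=\sup_{z\in\mathbb{S}^1}|\phi(z)-\widetilde\phi(z)|+\sup_{z\in\mathbb{S}^1}|\phi'(z)-\widetilde\phi'(z)|$. For $0<\theta<1$, $\mathcal{H}_\theta$ is the closure of the linear combinations of $z^k$, $k\in\mathbb{Z}$, with respect to $\|f\|_\theta=\sqrt{\sum_{k\in\mathbb{Z}}|f_k|^2\theta^{-2|k|}}$, where $f_k$ are the Fourier coefficients of $f$. A map $\phi\in\mathcal{B}^0$ is mixing at a double exponential rate if for some $0<\theta<1$ there exist $\beta,\gamma,C>0$ such that for all $f,g\in\mathcal{H}_\theta$ and all $n\ge1$, $\left|\int_{\mathbb{S}^1}(f\circ\phi^n)\,\overline{g}\,d\mu-\int_{\mathbb{S}^1}f\,d\mu\int_{\mathbb{S}^1}\overline{g}\,d\mu\right|\le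 Ce^{-\beta e^{\gamma n}}\|f\|_\theta\|g\|_\theta$, where $\phi^n$ is the $n$-fold iterate. *)

theory Defs
  imports "HOL-Complex_Analysis.Complex_Analysis"
begin

text \<open>
  A finite Blaschke product is represented by its formula as a total function on the complex
  plane. At a pole the formula evaluates to 0; this does not identify different
  products, since two of them that agree on the unit circle are equal
  (lemma \<open>blaschke_eq_if_eq_on_circle\<close>).
\<close>

definition finite_blaschke :: "(complex \<Rightarrow> complex) \<Rightarrow> bool" where
  "finite_blaschke \<phi> \<longleftrightarrow>
     (\<exists>(\<psi>::real) (q::nat) (l :: nat \<Rightarrow> complex).
        0 \<le> \<psi> \<and> \<psi> < 2 * pi \<and> 1 \<le> q \<and> (\<forall>i\<in>{1..q}. cmod (l i) < 1) \<and>
        \<phi> = (\<lambda>z. exp (\<i> * complex_of_real \<psi>) * (\<Prod>i=1..q. (z - l i) / (1 - cnj (l i) * z))))"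

definition B0 :: "(complex \<Rightarrow> complex) set" where
  "B0 = {\<phi>. finite_blaschke \<phi> \<and> \<phi> 0 = 0}"

text \<open>
  The value 0 outside \<open>B0\<close> is irrelevant for the topology. It is there because the suprema
  are only meaningful for functions that are bounded on the circle, while the locale
  \<open>Metric_space\<close> asks for nonnegativity on the whole type.
\<close>

definition C1_dist :: "(complex \<Rightarrow> complex) \<Rightarrow> (complex \<Rightarrow> complex) \<Rightarrow> real" where
  "C1_dist \<phi> \<psi> =
     (if \<phi> \<in> B0 \<and> \<psi> \<in> B0
      then (SUP z\<in>sphere 0 1. cmod (\<phi> z - \<psi> z)) + (SUP z\<in>sphere 0 1. cmod (deriv \<phi> z - deriv \<psi> z))
      else 0)"

definition B0_topology :: "(complex \<Rightarrow> complex) topology" where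
  "B0_topology = Metric_space.mtopology B0 C1_dist"

definition nowhere_dense_in :: "'a topology \<Rightarrow> 'a set \<Rightarrow> bool" where
  "nowhere_dense_in X S \<longleftrightarrow> S \<subseteq> topspace X \<and> X interior_of (X closure_of S) = {}"

text \<open>
  With \<open>z = cis t\<close> one has \<open>dz / (2 * pi * \<i> * z) = dt / (2 * pi)\<close>; see lemma
  \<open>integral_circle_measure\<close>. The underlying space of the measure is the circle itself, so
  values of functions off the circle play no role.
\<close>

definition circle_measure :: "complex measure" where
  "circle_measure =
     distr (uniform_measure lborel {0..2 * pi}) (restrict_space borel (sphere 0 1)) cis"

definition fourier_coeff :: "(complex \<Rightarrow> complex) \<Rightarrow> int \<Rightarrow> complex" where
  "fourier_coeff f k = (LINT z|circle_measure. f z * cnj (z powi k))"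

definition finite_H_norm :: "real \<Rightarrow> (complex \<Rightarrow> complex) \<Rightarrow> bool" where
  "finite_H_norm \<theta> f \<longleftrightarrow>
     (\<lambda>k. (cmod (fourier_coeff f k))\<^sup>2 * \<theta> powi (- 2 * \<bar>k\<bar>)) summable_on UNIV"

definition H_norm :: "real \<Rightarrow> (complex \<Rightarrow> complex) \<Rightarrow> real" where
  "H_norm \<theta> f = sqrt (\<Sum>\<^sub>\<infinity>k. (cmod (fourier_coeff f k))\<^sup>2 * \<theta> powi (- 2 * \<bar>k\<bar>))"

definition L2_circle :: "(complex \<Rightarrow> complex) set" where
  "L2_circle = {f \<in> borel_measurable circle_measure.
     integrable circle_measure (\<lambda>z. (cmod (f z))\<^sup>2)}"

definition trig_polys :: "(complex \<Rightarrow> complex) set" where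
  "trig_polys = {p. \<exists>(K :: int set) c. finite K \<and> p = (\<lambda>z. \<Sum>k\<in>K. c k * z powi k)}"

text \<open>
  The closure is taken among the square integrable functions on the circle, where Fourier
  coefficients are available; functions that agree almost everywhere are not identified. The
  finiteness condition is needed because \<open>H_norm\<close> of a function with divergent norm series
  is 0.
\<close>

definition H_space :: "real \<Rightarrow> (complex \<Rightarrow> complex) set" where
  "H_space \<theta> = {f \<in> L2_circle. \<forall>\<epsilon>>0. \<exists>p\<in>trig_polys.
     finite_H_norm \<theta> (\<lambda>z. f z - p z) \<and> H_norm \<theta> (\<lambda>z. f z - p z) < \<epsilon>}"

definition double_exp_mixing :: "(complex \<Rightarrow> complex) \<Rightarrow> bool" where
  "double_exp_mixing \<phi> \<longleftrightarrow>
     (\<exists>\<theta>::real. 0 < \<theta> \<and> \<theta> < 1 \<and>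
       (\<exists>(\<beta>::real) (\<gamma>::real) (C::real). 0 < \<beta> \<and> 0 < \<gamma> \<and> 0 < C \<and>
         (\<forall>f\<in>H_space \<theta>. \<forall>g\<in>H_space \<theta>. \<forall>n\<ge>1.
            cmod ((LINT z|circle_measure. f ((\<phi> ^^ n) z) * cnj (g z))
                  - (LINT z|circle_measure. f z) * (LINT z|circle_measure. cnj (g z)))
            \<le> C * exp (- \<beta> * exp (\<gamma> * real n)) * H_norm \<theta> f * H_norm \<theta> g)))"

lemma blaschke_denominator_nonzero:
  assumes "cmod a < 1" "cmod z \<le> 1"
  shows "1 - cnj a * z \<noteq> 0"
proof
  assume "1 - cnj a * z = 0"
  then have "cmod (cnj a * z) = 1" by (metis eq_iff_diff_eq_0 norm_one)
  moreover have "cmod (cnj a * z) \<le> cmod a * 1"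
    using assms by (simp add: norm_mult mult_left_le)
  ultimately show False using assms by simp
qed

lemma finite_blaschke_quotient:
  assumes "finite_blaschke \<phi>"
  obtains P Q where "P holomorphic_on UNIV" "Q holomorphic_on UNIV" "\<And>z. \<phi> z = P z / Q z"
    "\<And>z. cmod z \<le> 1 \<Longrightarrow> Q z \<noteq> 0" "\<And>z. Q z = 0 \<Longrightarrow> P z \<noteq> 0"
proof -
  from assms obtain \<psi> :: real and q :: nat and l where l: "\<forall>i\<in>{1..q}. cmod (l i) < 1"
    and \<phi>: "\<phi> = (\<lambda>z. exp (\<i> * complex_of_real \<psi>) * (\<Prod>i=1..q. (z - l i) / (1 - cnj (l i) * z)))"
    unfolding finite_blaschke_def by blast
  define P where "P = (\<lambda>z. exp (\<i> * complex_of_real \<psi>) * (\<Prod>i=1..q. (z - l i)))"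
  define Q where "Q = (\<lambda>z. \<Prod>i=1..q. (1 - cnj (l i) * z))"
  have Qnz: "Q z \<noteq> 0" if "cmod z \<le> 1" for z
    using l that blaschke_denominator_nonzero unfolding Q_def by (simp add: prod_zero_iff)
  show ?thesis
  proof (rule that)
    show "P holomorphic_on UNIV" "Q holomorphic_on UNIV"
      unfolding P_def Q_def by (intro holomorphic_intros)+
    show "\<phi> z = P z / Q z" for z
      by (simp add: \<phi> P_def Q_def prod_dividef)
    show "Q z \<noteq> 0" if "cmod z \<le> 1" for z by (rule Qnz[OF that])
    show "P z \<noteq> 0" if "Q z = 0" for z
    proof
      assume "P z = 0"
      then obtain i where "i \<in> {1..q}" "z = l i" by (auto simp: P_def prod_zero_iff)
      then have "cmod z \<le> 1" using l by force
      with Qnz that show False by blast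
    qed
  qed
qed

lemma blaschke_eq_if_eq_on_circle:
  assumes "finite_blaschke \<phi>" "finite_blaschke \<psi>" and eq: "\<And>z. cmod z = 1 \<Longrightarrow> \<phi> z = \<psi> z"
  shows "\<phi> = \<psi>"
proof -
  obtain P Q where PQ: "P holomorphic_on UNIV" "Q holomorphic_on UNIV" "\<And>z. \<phi> z = P z / Q z"
    "\<And>z. cmod z \<le> 1 \<Longrightarrow> Q z \<noteq> 0" "\<And>z. Q z = 0 \<Longrightarrow> P z \<noteq> 0"
    by (rule finite_blaschke_quotient[OF assms(1)]) (rule that)
  obtain R S where RS: "R holomorphic_on UNIV" "S holomorphic_on UNIV" "\<And>z. \<psi> z = R z / S z"
    "\<And>z. cmod z \<le> 1 \<Longrightarrow> S z \<noteq> 0" "\<And>z. S z = 0 \<Longrightarrow> R z \<noteq> 0"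
    by (rule finite_blaschke_quotient[OF assms(2)]) (rule that)
  have "P z * S z - R z * Q z = 0" for z
  proof (rule analytic_continuation[of "\<lambda>z. P z * S z - R z * Q z" UNIV "sphere 0 1" 1])
    show "(\<lambda>z. P z * S z - R z * Q z) holomorphic_on UNIV"
      using PQ RS by (intro holomorphic_intros)
    show "1 islimpt sphere (0::complex) 1"
    proof (rule connected_imp_perfect)
      have "(1::complex) \<in> sphere 0 1" "(-1::complex) \<in> sphere 0 1" "(1::complex) \<noteq> -1" by auto
      then show "sphere (0::complex) 1 \<noteq> {x}" for x by (metis singletonD)
    qed (auto intro!: connected_sphere)
    fix z :: complex assume "z \<in> sphere 0 1"
    then have "cmod z = 1" by simp
    with PQ(3,4)[of z] RS(3,4)[of z] eq[of z] show "P z * S z - R z * Q z = 0"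
      by (simp add: field_simps)
  qed auto
  then have *: "P z * S z = R z * Q z" for z by (metis eq_iff_diff_eq_0)
  show ?thesis
  proof
    fix z
    show "\<phi> z = \<psi> z"
    proof (cases "Q z = 0 \<or> S z = 0")
      case True
      then have "Q z = 0" "S z = 0" using *[of z] PQ(5) RS(5) by auto
      then show ?thesis using PQ(3) RS(3) by simp
    next
      case False
      then show ?thesis using *[of z] PQ(3) RS(3) by (simp add: field_simps)
    qed
  qed
qed

lemma finite_blaschke_holomorphic:
  assumes "finite_blaschke \<phi>"
  obtains U where "open U" "cball 0 1 \<subseteq> U" "\<phi> holomorphic_on U"
proof -
  obtain P Q where PQ: "P holomorphic_on UNIV" "Q holomorphic_on UNIV" "\<And>z. \<phi> z = P z / Q z"
    "\<And>z. cmod z \<le> 1 \<Longrightarrow> Q z \<noteq> 0"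
    by (rule finite_blaschke_quotient[OF assms]) (rule that)
  define U where "U = {z. Q z \<noteq> 0}"
  have "continuous_on UNIV Q" using PQ(2) by (rule holomorphic_on_imp_continuous_on)
  then have "open U" unfolding U_def by (intro open_Collect_neq continuous_intros)
  moreover have "cball 0 1 \<subseteq> U" using PQ(4) by (auto simp: U_def)
  moreover have "(\<lambda>z. P z / Q z) holomorphic_on U"
    using PQ(1,2) by (intro holomorphic_intros) (auto simp: U_def intro: holomorphic_on_subset)
  moreover have "\<phi> = (\<lambda>z. P z / Q z)" using PQ(3) by blast
  ultimately show ?thesis using that by metis
qed

lemma finite_blaschke_continuous_circle:
  assumes "finite_blaschke \<phi>"
  shows "continuous_on (sphere 0 1) \<phi>" "continuous_on (sphere 0 1) (deriv \<phi>)"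
proof -
  obtain U where U: "open U" "cball 0 1 \<subseteq> U" "\<phi> holomorphic_on U"
    using finite_blaschke_holomorphic[OF assms] by blast
  have "sphere (0::complex) 1 \<subseteq> U" using U(2) sphere_cball by blast
  then show "continuous_on (sphere 0 1) \<phi>" "continuous_on (sphere 0 1) (deriv \<phi>)"
    using U holomorphic_deriv[OF U(3,1)]
    by (meson continuous_on_subset holomorphic_on_imp_continuous_on)+
qed

lemma bdd_above_norm_diff_sphere:
  fixes f g :: "complex \<Rightarrow> complex"
  assumes "continuous_on (sphere 0 1) f" "continuous_on (sphere 0 1) g"
  shows "bdd_above ((\<lambda>z. cmod (f z - g z)) ` sphere 0 1)"
proof -
  have "compact ((\<lambda>z. cmod (f z - g z)) ` sphere 0 1)"
    using assms by (intro compact_continuous_image continuous_intros) auto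
  then show ?thesis by (simp add: bounded_imp_bdd_above compact_imp_bounded)
qed

lemma sup_norm_diff_facts:
  fixes f g h :: "complex \<Rightarrow> complex"
  assumes "continuous_on (sphere 0 1) f" "continuous_on (sphere 0 1) g" "continuous_on (sphere 0 1) h"
  shows "cmod z = 1 \<Longrightarrow> cmod (f z - g z) \<le> (SUP z\<in>sphere 0 1. cmod (f z - g z))"
    and "0 \<le> (SUP z\<in>sphere 0 1. cmod (f z - g z))"
    and "(SUP z\<in>sphere 0 1. cmod (f z - h z)) \<le>
          (SUP z\<in>sphere 0 1. cmod (f z - g z)) + (SUP z\<in>sphere 0 1. cmod (g z - h z))"
proof -
  have up: "cmod (u z - v z) \<le> (SUP z\<in>sphere 0 1. cmod (u z - v z))"
    if "continuous_on (sphere 0 1) u" "continuous_on (sphere 0 1) v" "cmod z = 1"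
    for u v :: "complex \<Rightarrow> complex" and z
    using that by (intro cSUP_upper bdd_above_norm_diff_sphere) auto
  show "cmod z = 1 \<Longrightarrow> cmod (f z - g z) \<le> (SUP z\<in>sphere 0 1. cmod (f z - g z))"
    using up assms by blast
  show "0 \<le> (SUP z\<in>sphere 0 1. cmod (f z - g z))"
    by (rule order_trans[OF norm_ge_zero up[OF assms(1,2), of 1]]) simp
  show "(SUP z\<in>sphere 0 1. cmod (f z - h z)) \<le>
          (SUP z\<in>sphere 0 1. cmod (f z - g z)) + (SUP z\<in>sphere 0 1. cmod (g z - h z))"
  proof (rule cSUP_least)
    fix z :: complex assume "z \<in> sphere 0 1"
    then have z: "cmod z = 1" by simp
    have "cmod (f z - h z) \<le> cmod (f z - g z) + cmod (g z - h z)"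
      using norm_triangle_ineq[of "f z - g z" "g z - h z"] by simp
    also have "\<dots> \<le> (SUP z\<in>sphere 0 1. cmod (f z - g z)) + (SUP z\<in>sphere 0 1. cmod (g z - h z))"
      using up assms z by (intro add_mono) auto
    finally show "cmod (f z - h z) \<le>
      (SUP z\<in>sphere 0 1. cmod (f z - g z)) + (SUP z\<in>sphere 0 1. cmod (g z - h z))" .
  qed auto
qed

lemma Metric_space_B0: "Metric_space B0 C1_dist"
proof
  have c: "continuous_on (sphere 0 1) \<phi>" "continuous_on (sphere 0 1) (deriv \<phi>)" if "\<phi> \<in> B0" for \<phi>
    using that finite_blaschke_continuous_circle by (auto simp: B0_def)
  fix x y z :: "complex \<Rightarrow> complex"
  show "0 \<le> C1_dist x y"
    using c sup_norm_diff_facts(2)[of x y x] sup_norm_diff_facts(2)[of "deriv x" "deriv y" "deriv x"]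
    by (simp add: C1_dist_def)
  show "C1_dist x y = C1_dist y x"
    by (simp add: C1_dist_def norm_minus_commute)
  show "C1_dist x y = 0 \<longleftrightarrow> x = y" if xy: "x \<in> B0" "y \<in> B0"
  proof
    assume "C1_dist x y = 0"
    then have "(SUP z\<in>sphere 0 1. cmod (x z - y z)) = 0"
      using xy c sup_norm_diff_facts(2)[of x y x] sup_norm_diff_facts(2)[of "deriv x" "deriv y" "deriv x"]
      by (simp add: C1_dist_def)
    then have "x w = y w" if "cmod w = 1" for w
      using sup_norm_diff_facts(1)[of x y x w] xy c that by simp
    then show "x = y"
      using blaschke_eq_if_eq_on_circle xy by (auto simp: B0_def)
  next
    assume "x = y"
    then show "C1_dist x y = 0" by (simp add: C1_dist_def)
  qed
  show "C1_dist x z \<le> C1_dist x y + C1_dist y z" if "x \<in> B0" "y \<in> B0" "z \<in> B0"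
    using that sup_norm_diff_facts(3)[of x y z] c
      sup_norm_diff_facts(3)[of "deriv x" "deriv y" "deriv z"]
    by (simp add: C1_dist_def)
qed

lemma topspace_B0_topology: "topspace B0_topology = B0"
  by (simp add: B0_topology_def Metric_space.topspace_mtopology[OF Metric_space_B0])

lemma cis_measurable_circle:
  "cis \<in> uniform_measure lborel {0..2 * pi} \<rightarrow>\<^sub>M restrict_space borel (sphere 0 1)"
proof (rule measurable_restrict_space2)
  have "continuous_on UNIV cis" by (intro continuous_intros)
  then show "cis \<in> uniform_measure lborel {0..2 * pi} \<rightarrow>\<^sub>M borel"
    using borel_measurable_continuous_onI[of cis] by simp
qed auto

lemma integral_circle_measure:
  fixes f :: "complex \<Rightarrow> complex"
  assumes "continuous_on (sphere 0 1) f"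
  shows "(LINT z|circle_measure. f z) = contour_integral (circlepath 0 1) (\<lambda>z. f z / z) / (2 * pi * \<i>)"
proof -
  have m: "f \<in> borel_measurable (restrict_space borel (sphere 0 1))"
    using assms by (rule borel_measurable_continuous_on_restrict)
  have cont: "continuous_on {0..2*pi} (\<lambda>t. f (cis t))"
    by (rule continuous_on_compose2[OF assms]) (auto intro!: continuous_intros)
  have int: "set_integrable lborel {0..2*pi} (\<lambda>t. f (cis t))"
    using cont by (rule borel_integrable_atLeastAtMost')
  have "(LINT z|circle_measure. f z) = (LINT t|uniform_measure lborel {0..2*pi}. f (cis t))"
    unfolding circle_measure_def by (rule integral_distr[OF cis_measurable_circle m])
  also have "\<dots> = (LINT t:{0..2*pi}|lborel. f (cis t)) / (2 * pi)"
  proof -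
    have m': "(\<lambda>t. f (cis t)) \<in> borel_measurable lborel"
    proof -
      have "cis \<in> lborel \<rightarrow>\<^sub>M restrict_space borel (sphere 0 1)"
        using cis_measurable_circle by simp
      then show ?thesis using m by (rule measurable_compose)
    qed
    have "uniform_measure lborel {0..2*pi} = density lborel (\<lambda>t. ennreal (indicator {0..2*pi} t / (2*pi)))"
      unfolding uniform_measure_def
      by (intro arg_cong[of _ _ "density lborel"] ext)
         (auto simp: divide_ennreal[symmetric] split: split_indicator)
    then have "(LINT t|uniform_measure lborel {0..2*pi}. f (cis t)) =
        (LINT t|lborel. (indicator {0..2*pi} t / (2*pi)) *\<^sub>R f (cis t))"
      using m' by (simp add: integral_density)
    also have "\<dots> = (LINT t|lborel. (indicator {0..2*pi} t *\<^sub>R f (cis t)) / (2*pi))"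
      by (intro Bochner_Integration.integral_cong refl) (simp add: scaleR_conv_of_real)
    finally show ?thesis
      unfolding set_lebesgue_integral_def by simp
  qed
  also have "(LINT t:{0..2*pi}|lborel. f (cis t)) = integral {0..2*pi} (\<lambda>t. f (cis t))"
    using int by (rule set_borel_integral_eq_integral(2))
  also have "\<dots> = contour_integral (circlepath 0 1) (\<lambda>z. f z / z) / \<i>"
  proof -
    have "contour_integral (circlepath 0 1) (\<lambda>z. f z / z) = integral {0..2*pi} (\<lambda>t. f (cis t) * \<i>)"
      unfolding circlepath_def by (subst contour_integral_part_circlepath_eq) simp_all
    then have "contour_integral (circlepath 0 1) (\<lambda>z. f z / z) = integral {0..2*pi} (\<lambda>t. f (cis t)) * \<i>"
      by simp
    then show ?thesis by (metis complex_i_not_zero nonzero_mult_div_cancel_right)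
  qed
  finally show ?thesis by (simp add: field_simps)
qed

end

theory Submission
  imports Defs "HOL-Real_Asymp.Real_Asymp" "HOL-Probability.Probability_Measure"
begin

text \<open>
  A Blaschke product \<open>\<phi>\<close> that fixes 0 and mixes at a double exponential rate is superattracting
  at 0, that is, \<open>deriv \<phi> 0 = 0\<close>. To see this, test mixing on the single observable
  \<open>f z = g z = z\<close>. It has mean 0, and its \<open>n\<close>-th correlation is the first Fourier coefficient of
  the \<open>n\<close>-th iterate. The iterate is holomorphic in the disc, so this is its first Taylor
  coefficient at 0, which by the chain rule at the fixed point is \<open>deriv \<phi> 0 ^ n\<close>. A geometric
  sequence cannot decay double exponentially unless its ratio is 0
  (lemma \<open>deriv_zero_if_double_exp_mixing\<close>).

  It remains to see that the superattracting products form a closed set with empty interior.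
  Closedness follows from Cauchy's estimate: the derivative at 0 is controlled by the values on
  the circle (lemma \<open>norm_deriv_diff_le_C1_dist\<close>). The interior is empty because \<open>deriv \<phi> 0 = 0\<close>
  forces 0 to be a multiple zero of \<open>\<phi>\<close>: moving all but one of the zeros at 0 slightly away
  leaves a simple zero there and changes \<open>\<phi>\<close> little in the \<open>C\<^sup>1\<close> metric
  (lemma \<open>B0_nonzero_deriv_dense\<close>).
\<close>

section \<open>Fourier coefficients and mixing\<close>

text \<open>
  On the unit circle \<open>cnj z = 1 / z\<close>, which turns the Fourier integral into Cauchy's integral
  for the \<open>k\<close>-th derivative.
\<close>

lemma fourier_coeff_eq_taylor_coeff:
  assumes "continuous_on (cball 0 1) h" "h holomorphic_on ball 0 1"
  shows "(LINT z|circle_measure. h z * cnj (z ^ k)) = (deriv ^^ k) h 0 / fact k"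
proof -
  have "continuous_on (sphere 0 1) (\<lambda>z. h z * cnj (z ^ k))"
    using continuous_on_subset[OF assms(1) sphere_cball] by (intro continuous_intros)
  then have "(LINT z|circle_measure. h z * cnj (z ^ k)) =
      contour_integral (circlepath 0 1) (\<lambda>z. h z * cnj (z ^ k) / z) / (2 * pi * \<i>)"
    by (rule integral_circle_measure)
  also have "contour_integral (circlepath 0 1) (\<lambda>z. h z * cnj (z ^ k) / z) =
      contour_integral (circlepath 0 1) (\<lambda>z. h z / (z - 0) ^ Suc k)"
  proof (rule contour_integral_eq)
    fix z :: complex assume "z \<in> path_image (circlepath 0 1)"
    then have "cmod z = 1" by simp
    then have "z * cnj z = 1" "z \<noteq> 0" by (auto simp: complex_norm_square[symmetric])
    then have "cnj z = 1 / z" by (simp add: field_simps)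
    then show "h z * cnj (z ^ k) / z = h z / (z - 0) ^ Suc k"
      using \<open>z \<noteq> 0\<close> by (simp add: power_divide)
  qed
  also have "\<dots> = 2 * pi * \<i> / fact k * (deriv ^^ k) h 0"
    by (rule contour_integral_unique
          [OF Cauchy_has_contour_integral_higher_derivative_circlepath[OF assms]]) simp
  finally show ?thesis by simp
qed

text \<open>
  The identity is itself a trigonometric polynomial, so it is approximated by itself with
  error 0, whatever the weights are.
\<close>

lemma identity_in_H_space: "(\<lambda>z. z) \<in> H_space \<theta>"
proof -
  have prob: "prob_space (uniform_measure lborel {0..2 * pi})"
    by (intro prob_space_uniform_measure) auto
  have sets: "sets circle_measure = sets (restrict_space borel (sphere 0 1))"
    and space: "space circle_measure = sphere 0 1"
    by (simp_all add: circle_measure_def space_restrict_space)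
  interpret prob_space circle_measure
    unfolding circle_measure_def using prob cis_measurable_circle
    by (rule prob_space.prob_space_distr)
  have m: "(\<lambda>z::complex. z) \<in> borel_measurable circle_measure"
    by (simp add: measurable_cong_sets[OF sets refl] measurable_restrict_space1)
  have "integrable circle_measure (\<lambda>z::complex. (cmod z)\<^sup>2)"
    using m by (intro integrable_const_bound[where B = 1]) (auto intro!: AE_I2 simp: space)
  with m have "(\<lambda>z. z) \<in> L2_circle" by (simp add: L2_circle_def)
  moreover have "(\<lambda>z. z) \<in> trig_polys"
    unfolding trig_polys_def
    by (intro CollectI exI[of _ "{1}"] exI[of _ "\<lambda>_. 1"]) auto
  ultimately show ?thesis
    unfolding H_space_def
    by (auto intro!: bexI[of _ "\<lambda>z. z"] simp: fourier_coeff_def finite_H_norm_def H_norm_def)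
qed

lemma not_double_exp_decay_of_geometric:
  fixes a :: real
  assumes "0 \<le> a" "0 < \<beta>" "0 < \<gamma>"
    and le: "\<And>n. 1 \<le> n \<Longrightarrow> a ^ n \<le> C * exp (- \<beta> * exp (\<gamma> * real n))"
  shows "a = 0"
proof (rule ccontr)
  assume "a \<noteq> 0"
  then have "0 < a" using assms(1) by simp
  \<comment> \<open>A positive rate \<open>M\<close> keeps the asymptotic comparison free of a case split on the sign
    of \<open>ln a\<close>.\<close>
  define M where "M = \<bar>ln a\<bar> + 1"
  have "0 < M" by (simp add: M_def)
  have "exp (- M) \<le> a"
  proof -
    have "exp (- M) \<le> exp (ln a)" by (subst exp_le_cancel_iff) (simp add: M_def)
    then show ?thesis using \<open>0 < a\<close> by simp
  qed
  have "((\<lambda>n. C * exp (M * real n - \<beta> * exp (\<gamma> * real n))) \<longlongrightarrow> 0) sequentially"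
    using assms(2,3) \<open>0 < M\<close> by real_asymp
  then have "\<forall>\<^sub>F n in sequentially. C * exp (M * real n - \<beta> * exp (\<gamma> * real n)) < 1"
    by (rule order_tendstoD) simp
  then obtain N where N: "\<And>n. N \<le> n \<Longrightarrow> C * exp (M * real n - \<beta> * exp (\<gamma> * real n)) < 1"
    unfolding eventually_sequentially by blast
  define n where "n = max 1 N"
  have n: "1 \<le> n" "C * exp (M * real n - \<beta> * exp (\<gamma> * real n)) < 1"
    using N[of n] by (auto simp: n_def)
  have "exp (- M) ^ n \<le> a ^ n" using \<open>exp (- M) \<le> a\<close> by (intro power_mono) auto
  then have "exp (- (M * real n)) \<le> C * exp (- \<beta> * exp (\<gamma> * real n))"
    using le[OF n(1)] by (simp add: exp_of_nat_mult[symmetric] mult.commute)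
  then have "exp (M * real n) * exp (- (M * real n)) \<le> 
     exp (M * real n) * (C * exp (- \<beta> * exp (\<gamma> * real n)))"
    by (rule mult_left_mono) simp
  then show False
    using n(2) by (simp add: exp_add[symmetric] exp_diff exp_minus field_simps)
qed

section \<open>Iterates of a Blaschke product\<close>

text \<open>
  This is the Schwarz-Pick identity
  \<open>\<bar>1 - cnj a * z\<bar>\<^sup>2 - \<bar>z - a\<bar>\<^sup>2 = (1 - \<bar>a\<bar>\<^sup>2) * (1 - \<bar>z\<bar>\<^sup>2)\<close>, whose right-hand side is nonnegative.
\<close>

lemma blaschke_factor_norm_le_1:
  assumes "cmod a < 1" "cmod z \<le> 1"
  shows "cmod ((z - a) / (1 - cnj a * z)) \<le> 1"
proof -
  have id: "(cmod (1 - cnj a * z))\<^sup>2 - (cmod (z - a))\<^sup>2 = (1 - (cmod a)\<^sup>2) * (1 - (cmod z)\<^sup>2)"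
    by (simp only: cmod_power2) (simp add: algebra_simps power2_eq_square)
  have "(cmod a)\<^sup>2 \<le> 1" "(cmod z)\<^sup>2 \<le> 1" using assms by (simp_all add: power_le_one)
  then have "0 \<le> (1 - (cmod a)\<^sup>2) * (1 - (cmod z)\<^sup>2)" by simp
  then have "(cmod (z - a))\<^sup>2 \<le> (cmod (1 - cnj a * z))\<^sup>2" using id by linarith
  then have "cmod (z - a) \<le> cmod (1 - cnj a * z)" by (rule power2_le_imp_le) simp
  then show ?thesis
    using blaschke_denominator_nonzero[OF assms] by (simp add: norm_divide)
qed

lemma finite_blaschke_norm_le_1:
  assumes "finite_blaschke \<phi>" "cmod z \<le> 1"
  shows "cmod (\<phi> z) \<le> 1"
proof -
  obtain \<psi> :: real and q :: nat and l where "\<forall>i\<in>{1..q}. cmod (l i) < 1"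
    and "\<phi> = (\<lambda>z. exp (\<i> * complex_of_real \<psi>) * (\<Prod>i=1..q. (z - l i) / (1 - cnj (l i) * z)))"
    using assms(1) unfolding finite_blaschke_def by blast
  then show ?thesis
    using assms(2)
    by (auto simp: norm_mult prod_norm[symmetric] simp del: One_nat_def
             intro!: prod_le_1 blaschke_factor_norm_le_1)
qed

text \<open>
  Iterates stay holomorphic in the disc because the closed disc is mapped into itself and \<open>\<phi>\<close>
  is holomorphic in a neighbourhood of it, so no pole is ever met.
\<close>

lemma finite_blaschke_funpow:
  assumes "finite_blaschke \<phi>"
  shows "continuous_on (cball 0 1) (\<phi> ^^ n)" "(\<phi> ^^ n) holomorphic_on ball 0 1"
    "(\<phi> ^^ n) ` cball 0 1 \<subseteq> cball 0 1"
proof -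
  obtain U where U: "open U" "cball 0 1 \<subseteq> U" "\<phi> holomorphic_on U"
    using finite_blaschke_holomorphic[OF assms] by blast
  have cont: "continuous_on (cball 0 1) \<phi>"
    using U by (meson continuous_on_subset holomorphic_on_imp_continuous_on)
  have "continuous_on (cball 0 1) (\<phi> ^^ n) \<and> (\<phi> ^^ n) holomorphic_on ball 0 1 \<and>
    (\<phi> ^^ n) ` cball 0 1 \<subseteq> cball 0 1"
  proof (induction n)
    case 0
    have "(\<lambda>x. x) holomorphic_on ball (0::complex) 1" by (rule holomorphic_on_ident)
    then show ?case by (simp add: id_def)
  next
    case (Suc n)
    then have IH: "continuous_on (cball 0 1) (\<phi> ^^ n)" "(\<phi> ^^ n) holomorphic_on ball 0 1"
      "(\<phi> ^^ n) ` cball 0 1 \<subseteq> cball 0 1" by auto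
    have "continuous_on (cball 0 1) (\<phi> \<circ> (\<phi> ^^ n))"
      using IH cont by (meson continuous_on_compose continuous_on_subset)
    moreover have "(\<phi> \<circ> (\<phi> ^^ n)) holomorphic_on ball 0 1"
      using IH U by (intro holomorphic_on_compose_gen[OF IH(2) U(3)]) (use ball_subset_cball in blast)
    moreover have "(\<phi> \<circ> (\<phi> ^^ n)) ` cball 0 1 \<subseteq> cball 0 1"
      using IH(3) finite_blaschke_norm_le_1[OF assms] by (auto simp: image_subset_iff)
    ultimately show ?case by (simp only: funpow.simps)
  qed
  then show "continuous_on (cball 0 1) (\<phi> ^^ n)" "(\<phi> ^^ n) holomorphic_on ball 0 1"
    "(\<phi> ^^ n) ` cball 0 1 \<subseteq> cball 0 1" by auto
qed

lemma deriv_funpow_fixpoint: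
  fixes \<phi> :: "complex \<Rightarrow> complex"
  assumes "\<phi> field_differentiable at p" "\<phi> p = p"
  shows "deriv (\<phi> ^^ n) p = deriv \<phi> p ^ n"
proof -
  have "((\<phi> ^^ n) has_field_derivative deriv \<phi> p ^ n) (at p)"
  proof (induction n)
    case 0
    then show ?case by (simp add: id_def)
  next
    case (Suc n)
    have "(\<phi> ^^ n) p = p" by (induction n) (simp_all add: assms(2))
    then have "(\<phi> has_field_derivative deriv \<phi> p) (at ((\<phi> ^^ n) p))"
      using assms(1) by (simp add: DERIV_deriv_iff_field_differentiable)
    from DERIV_chain[OF this Suc] show ?case by (simp only: funpow.simps power_Suc)
  qed
  then show ?thesis by (rule DERIV_imp_deriv)
qed

text \<open>
  The multiplier at the fixed point 0 is an obstruction to fast mixing: the correlation of the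
  identity with itself after \<open>n\<close> steps is exactly \<open>deriv \<phi> 0 ^ n\<close>.
\<close>

lemma deriv_zero_if_double_exp_mixing:
  assumes "\<phi> \<in> B0" "double_exp_mixing \<phi>"
  shows "deriv \<phi> 0 = 0"
proof -
  have bl: "finite_blaschke \<phi>" and fp: "\<phi> 0 = 0" using assms(1) by (auto simp: B0_def)
  obtain \<theta> \<beta> \<gamma> C where pos: "0 < \<beta>" "0 < \<gamma>" and mix: "\<forall>f\<in>H_space \<theta>. \<forall>g\<in>H_space \<theta>. \<forall>n\<ge>1.
      cmod ((LINT z|circle_measure. f ((\<phi> ^^ n) z) * cnj (g z))
            - (LINT z|circle_measure. f z) * (LINT z|circle_measure. cnj (g z)))
      \<le> C * exp (- \<beta> * exp (\<gamma> * real n)) * H_norm \<theta> f * H_norm \<theta> g"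
    using assms(2) unfolding double_exp_mixing_def by blast
  \<comment> \<open>The observable is fixed, so its norms only contribute to the constant.\<close>
  define K where "K = C * H_norm \<theta> (\<lambda>z. z) * H_norm \<theta> (\<lambda>z. z)"
  have diff: "\<phi> field_differentiable at 0"
  proof -
    have "\<phi> holomorphic_on ball 0 1" using finite_blaschke_funpow(2)[OF bl, of 1] by simp
    then show ?thesis by (rule holomorphic_on_imp_differentiable_at) auto
  qed
  have mean: "(LINT z|circle_measure. z) = 0"
    using fourier_coeff_eq_taylor_coeff[of "\<lambda>z. z" 0] by (simp add: holomorphic_on_ident)
  have "cmod (deriv \<phi> 0) ^ n \<le> K * exp (- \<beta> * exp (\<gamma> * real n))" if "1 \<le> n" for n
  proof -
    have "(LINT z|circle_measure. (\<phi> ^^ n) z * cnj z) = deriv \<phi> 0 ^ n"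
      using fourier_coeff_eq_taylor_coeff[OF finite_blaschke_funpow(1,2)[OF bl], of n 1]
      by (simp add: deriv_funpow_fixpoint[OF diff fp])
    moreover have "cmod ((LINT z|circle_measure. (\<phi> ^^ n) z * cnj z)
        - (LINT z|circle_measure. z) * (LINT z|circle_measure. cnj z))
      \<le> C * exp (- \<beta> * exp (\<gamma> * real n)) * H_norm \<theta> (\<lambda>z. z) * H_norm \<theta> (\<lambda>z. z)"
      using mix[rule_format, OF identity_in_H_space identity_in_H_space that] .
    ultimately show ?thesis by (simp add: mean K_def norm_power mult_ac)
  qed
  then have "cmod (deriv \<phi> 0) = 0"
    by (rule not_double_exp_decay_of_geometric[OF norm_ge_zero pos])
  then show ?thesis by simp
qed

section \<open>Topology of the superattracting locus\<close>

text \<open>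
  Cauchy's inequality on the unit circle bounds the derivative at 0 by the supremum norm alone,
  which is one of the two summands of \<open>C1_dist\<close>.
\<close>

lemma norm_deriv_diff_le_C1_dist:
  assumes "\<phi> \<in> B0" "\<eta> \<in> B0"
  shows "cmod (deriv \<phi> 0 - deriv \<eta> 0) \<le> C1_dist \<phi> \<eta>"
proof -
  have bl: "finite_blaschke \<phi>" "finite_blaschke \<eta>" using assms by (auto simp: B0_def)
  note reg = finite_blaschke_funpow(1,2)[OF bl(1), of 1] finite_blaschke_funpow(1,2)[OF bl(2), of 1]
  have hol: "\<phi> holomorphic_on ball 0 1" "\<eta> holomorphic_on ball 0 1"
    and cont: "continuous_on (cball 0 1) \<phi>" "continuous_on (cball 0 1) \<eta>"
    using reg by simp_all
  note circ = finite_blaschke_continuous_circle[OF bl(1)] finite_blaschke_continuous_circle[OF bl(2)]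
  define S where "S = (SUP z\<in>sphere 0 1. cmod (\<phi> z - \<eta> z))"
  have "cmod ((deriv ^^ 1) (\<lambda>z. \<phi> z - \<eta> z) 0) \<le> fact 1 * S / 1 ^ 1"
  proof (rule Cauchy_inequality)
    fix z :: complex assume "cmod (0 - z) = 1"
    then show "cmod (\<phi> z - \<eta> z) \<le> S"
      unfolding S_def by (intro sup_norm_diff_facts(1)[OF circ(1,3,1)]) simp
  qed (use hol cont in \<open>auto intro!: holomorphic_intros continuous_intros\<close>)
  then have "cmod (deriv (\<lambda>z. \<phi> z - \<eta> z) 0) \<le> S" by simp
  moreover have "deriv (\<lambda>z. \<phi> z - \<eta> z) 0 = deriv \<phi> 0 - deriv \<eta> 0"
    using hol by (intro deriv_diff holomorphic_on_imp_differentiable_at) auto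
  moreover have "S \<le> C1_dist \<phi> \<eta>"
    using assms sup_norm_diff_facts(2)[OF circ(2,4,2)] by (simp add: C1_dist_def S_def)
  ultimately show ?thesis by simp
qed

text \<open>
  A jointly continuous family on a compact set is uniformly continuous, hence converges uniformly
  as the parameter tends to 0. This is used both for the perturbed products and for their
  derivatives.
\<close>

lemma uniformly_close_in_parameter:
  fixes f :: "real \<Rightarrow> complex \<Rightarrow> complex"
  assumes cont: "continuous_on ({0..r} \<times> K) (\<lambda>(t, z). f t z)" and "compact K" "0 < r" "0 < e"
  obtains d where "0 < d" "\<And>t z. 0 \<le> t \<Longrightarrow> t < d \<Longrightarrow> z \<in> K \<Longrightarrow> cmod (f 0 z - f t z) < e"
proof -
  have "uniformly_continuous_on ({0..r} \<times> K) (\<lambda>(t, z). f t z)"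
    using assms by (intro compact_uniformly_continuous compact_Times) auto
  then obtain d where "0 < d" and d: "\<And>x y. x \<in> {0..r} \<times> K \<Longrightarrow> y \<in> {0..r} \<times> K \<Longrightarrow> dist y x < d \<Longrightarrow>
      dist ((\<lambda>(t, z). f t z) y) ((\<lambda>(t, z). f t z) x) < e"
    unfolding uniformly_continuous_on_def using \<open>0 < e\<close> by meson
  show ?thesis
  proof (rule that[of "min d r"])
    fix t z assume "0 \<le> t" "t < min d r" "z \<in> K"
    then show "cmod (f 0 z - f t z) < e"
      using d[of "(t, z)" "(0, z)"] \<open>0 < r\<close> by (simp add: dist_Pair_Pair dist_norm)
  qed (use \<open>0 < d\<close> \<open>0 < r\<close> in auto)
qed

lemma has_field_derivative_blaschke_product:
  assumes "\<And>i. i \<in> I \<Longrightarrow> cmod (l i) < 1" "cmod z \<le> 1"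
  shows "((\<lambda>z. c * (\<Prod>i\<in>I. (z - l i) / (1 - cnj (l i) * z))) has_field_derivative
      c * (\<Sum>i\<in>I. (1 - cnj (l i) * l i) / (1 - cnj (l i) * z)\<^sup>2 *
        (\<Prod>j\<in>I - {i}. (z - l j) / (1 - cnj (l j) * z)))) (at z)"
proof -
  have "((\<lambda>z. (z - l i) / (1 - cnj (l i) * z)) has_field_derivative
      (1 - cnj (l i) * l i) / (1 - cnj (l i) * z)\<^sup>2) (at z)" if "i \<in> I" for i
  proof -
    have "1 - cnj (l i) * z \<noteq> 0" using assms that blaschke_denominator_nonzero by blast
    then show ?thesis
      by (auto intro!: derivative_eq_intros simp: power2_eq_square algebra_simps)
  qed
  then show ?thesis by (intro DERIV_cmult has_field_derivative_prod)
qed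

text \<open>
  Keep one zero \<open>l k = 0\<close> and move every other zero that lies at 0 to the point \<open>t > 0\<close>. The new
  product \<open>F t\<close> still vanishes at 0, but only to first order, and as \<open>t\<close> tends to 0 it tends to
  \<open>\<phi>\<close> together with its derivative, uniformly on the circle.
\<close>

lemma B0_nonzero_deriv_dense:
  assumes "\<phi> \<in> B0" "0 < e"
  obtains \<eta> where "\<eta> \<in> B0" "C1_dist \<phi> \<eta> < e" "deriv \<eta> 0 \<noteq> 0"
proof -
  from assms(1) obtain \<psi> :: real and q :: nat and l
    where \<psi>: "0 \<le> \<psi>" "\<psi> < 2 * pi" and q: "1 \<le> q" and l: "\<forall>i\<in>{1..q}. cmod (l i) < 1"
      and \<phi>: "\<phi> = (\<lambda>z. exp (\<i> * complex_of_real \<psi>) * (\<Prod>i=1..q. (z - l i) / (1 - cnj (l i) * z)))"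
      and "\<phi> 0 = 0"
    unfolding B0_def finite_blaschke_def by blast
  then obtain k where k: "k \<in> {1..q}" "l k = 0" by (auto simp: prod_zero_iff)
  define c where "c = exp (\<i> * complex_of_real \<psi>)"
  have "c \<noteq> 0" by (simp add: c_def)
  define m where "m t i = (if i \<noteq> k \<and> l i = 0 then complex_of_real t else l i)" for t i
  define F where "F t z = c * (\<Prod>i=1..q. (z - m t i) / (1 - cnj (m t i) * z))" for t z
  define G where "G t z = c * (\<Sum>i=1..q. (1 - cnj (m t i) * m t i) / (1 - cnj (m t i) * z)\<^sup>2 *
        (\<Prod>j\<in>{1..q} - {i}. (z - m t j) / (1 - cnj (m t j) * z)))" for t z
  have F0: "F 0 = \<phi>" by (auto simp: F_def m_def \<phi> c_def fun_eq_iff intro!: prod.cong)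
  have m_less: "cmod (m t i) < 1" if "t \<in> {0..1/2}" "i \<in> {1..q}" for t i
    using that l by (auto simp: m_def)
  have m_k: "m t k = 0" for t by (simp add: m_def k)
  have F_B0: "F t \<in> B0" if "t \<in> {0..1/2}" for t
  proof -
    have "finite_blaschke (F t)"
      unfolding finite_blaschke_def
      by (intro exI[of _ \<psi>] exI[of _ q] exI[of _ "m t"]) (use that \<psi> q m_less in \<open>auto simp: F_def c_def\<close>)
    moreover have "F t 0 = 0" using k(1) m_k[of t] unfolding F_def by (auto simp: prod_zero_iff)
    ultimately show ?thesis by (simp add: B0_def)
  qed
  have deriv_F: "deriv (F t) z = G t z" if "t \<in> {0..1/2}" "cmod z \<le> 1" for t z
    unfolding F_def G_def using that m_less
    by (intro DERIV_imp_deriv has_field_derivative_blaschke_product) auto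
  have deriv_F_0: "deriv (F t) 0 \<noteq> 0" if "t \<in> {0<..1/2}" for t
  proof -
    \<comment> \<open>At 0 the \<open>k\<close>-th factor vanishes, so only the summand that differentiates it survives.\<close>
    have "G t 0 = c * (\<Sum>i=1..q. if i = k then \<Prod>j\<in>{1..q} - {k}. - m t j else 0)"
      unfolding G_def
    proof (intro arg_cong[of _ _ "\<lambda>x. c * x"] sum.cong refl)
      fix i assume "i \<in> {1..q}"
      show "(1 - cnj (m t i) * m t i) / (1 - cnj (m t i) * 0)\<^sup>2 *
          (\<Prod>j\<in>{1..q} - {i}. (0 - m t j) / (1 - cnj (m t j) * 0)) =
        (if i = k then \<Prod>j\<in>{1..q} - {k}. - m t j else 0)"
      proof (cases "i = k")
        case False
        then have "(\<Prod>j\<in>{1..q} - {i}. (0 - m t j) / (1 - cnj (m t j) * 0)) = 0"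
          using k(1) m_k[of t] by (intro prod_zero) (auto intro!: bexI[of _ k])
        with False show ?thesis by simp
      qed (simp add: m_k)
    qed
    also have "\<dots> = c * (\<Prod>j\<in>{1..q} - {k}. - m t j)" using k by simp
    also have "\<dots> \<noteq> 0" using that \<open>c \<noteq> 0\<close> by (auto simp: prod_zero_iff m_def)
    finally show ?thesis using deriv_F[of t 0] that by simp
  qed
  have cont_m: "continuous_on A (\<lambda>p. m (fst p) i)" for A :: "(real \<times> complex) set" and i
    by (cases "i \<noteq> k \<and> l i = 0") (auto simp: m_def intro!: continuous_intros)
  have nz: "1 - cnj (m (fst p) i) * snd p \<noteq> 0" if "p \<in> {0..1/2} \<times> sphere 0 1" "i \<in> {1..q}" for p i
    using that m_less by (intro blaschke_denominator_nonzero) auto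
  have "continuous_on ({0..1/2} \<times> sphere 0 1) (\<lambda>(t, z). F t z)"
    unfolding F_def case_prod_unfold by (intro continuous_intros cont_m ballI nz) auto
  then obtain d1 where d1: "0 < d1"
    "\<And>t z. 0 \<le> t \<Longrightarrow> t < d1 \<Longrightarrow> z \<in> sphere 0 1 \<Longrightarrow> cmod (F 0 z - F t z) < e / 3"
    by (rule uniformly_close_in_parameter[where e = "e / 3"]) (use assms(2) in auto)
  have "continuous_on ({0..1/2} \<times> sphere 0 1) (\<lambda>(t, z). G t z)"
    unfolding G_def case_prod_unfold
    by (intro continuous_intros cont_m ballI) (use nz in auto)
  then obtain d2 where d2: "0 < d2"
    "\<And>t z. 0 \<le> t \<Longrightarrow> t < d2 \<Longrightarrow> z \<in> sphere 0 1 \<Longrightarrow> cmod (G 0 z - G t z) < e / 3"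
    by (rule uniformly_close_in_parameter[where e = "e / 3"]) (use assms(2) in auto)
  define t where "t = min (min (d1 / 2) (d2 / 2)) (1 / 2)"
  have t: "0 < t" "t < d1" "t < d2" "t \<le> 1 / 2" using d1(1) d2(1) by (auto simp: t_def)
  show ?thesis
  proof (rule that)
    show "F t \<in> B0" "deriv (F t) 0 \<noteq> 0" using F_B0 deriv_F_0 t by auto
    have "(SUP z\<in>sphere 0 1. cmod (\<phi> z - F t z)) \<le> e / 3"
      using d1(2)[of t] t by (intro cSUP_least) (auto simp: F0[symmetric] less_imp_le)
    moreover have "(SUP z\<in>sphere 0 1. cmod (deriv \<phi> z - deriv (F t) z)) \<le> e / 3"
      using d2(2)[of t] t by (intro cSUP_least) (auto simp: F0[symmetric] deriv_F less_imp_le)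
    ultimately show "C1_dist \<phi> (F t) < e"
      using assms F_B0[of t] t by (simp add: C1_dist_def)
  qed
qed

theorem proposition6p2:
  shows "nowhere_dense_in B0_topology {\<phi> \<in> B0. double_exp_mixing \<phi>}"
proof -
  interpret Metric_space B0 C1_dist by (rule Metric_space_B0)
  let ?S = "{\<phi> \<in> B0. double_exp_mixing \<phi>}"
  have clos: "deriv \<phi> 0 = 0" if "\<phi> \<in> mtopology closure_of ?S" for \<phi>
  proof -
    have "cmod (deriv \<phi> 0) < r" if "0 < r" for r
    proof -
      obtain \<eta> where \<eta>: "\<eta> \<in> ?S" "\<eta> \<in> mball \<phi> r"
        using \<open>\<phi> \<in> mtopology closure_of ?S\<close> \<open>0 < r\<close> unfolding metric_closure_of by blast
      then have "deriv \<eta> 0 = 0" using deriv_zero_if_double_exp_mixing by blast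
      then show ?thesis
        using \<eta>(2) norm_deriv_diff_le_C1_dist[of \<phi> \<eta>] by (simp add: in_mball)
    qed
    from this[of "cmod (deriv \<phi> 0)"] show ?thesis by auto
  qed
  have "mtopology interior_of (mtopology closure_of ?S) = {}"
  proof (rule equals0I)
    fix \<phi> assume "\<phi> \<in> mtopology interior_of (mtopology closure_of ?S)"
    then obtain e where "\<phi> \<in> B0" "0 < e" and e: "mball \<phi> e \<subseteq> mtopology closure_of ?S"
      unfolding metric_interior_of by blast
    then obtain \<eta> where \<eta>: "\<eta> \<in> B0" "C1_dist \<phi> \<eta> < e" "deriv \<eta> 0 \<noteq> 0"
      using B0_nonzero_deriv_dense by blast
    then have "\<eta> \<in> mball \<phi> e" using \<open>\<phi> \<in> B0\<close> by (simp add: in_mball)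
    then show False using e clos \<eta>(3) by blast
  qed
  then show ?thesis
    unfolding nowhere_dense_in_def topspace_B0_topology by (auto simp: B0_topology_def)
qed

end
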